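(* For any positive integer $n$, $$\sum_{M}x^{a(M)} = \sum_{M}x^{c(M)},$$ where both sums are over all bicubic maps $M$ on $n$ vertices, $a(M)$ is the number of $1$-colored faces of $M$ that touch the root face $R_3$, and $c(M)$ is the number of $3$-colored faces of $M$ that touch the face $R_2$. In other words, the statistics $a$ and $c$ are equidistributed.
   Context: A planar map is a connected graph (multiple edges allowed) embedded in the sphere with no edge-crossings, considered up to continuous deformations. Maps are rooted: a directed edge is distinguished as the root edge. The face to the right of the root edge, when following its orientation, is the root face, and the vertex from which the root edge stems is the root vertex. A planar map is cubic if every vertex has degree 3, and bicubic if in addition it is bipartite, i.e. its vertices can be colored black and white so that adjacent vertices have different colors. The faces of a bicubic map can be colored with colors $1,2,3$ so that adjacent faces have distinct colors and the colors $1,2,3$ appear in counterclockwise order around white vertices; by convention the root vertex is black and the root face has color $3$ (this fixes the colorings). $R_1,R_2,R_3$ denote the three faces around the root vertex, where $R_i$ has color $i$; in particular $R_3$ is the root face. Two faces touch if there is an edge belonging to the boundaries of both. *)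

theory Defs
  imports
    "HOL-Combinatorics.Orbits"
    "HOL-Computational_Algebra.Polynomial"
begin

text \<open>
  Maps on oriented surfaces are encoded by their darts (directed edges): \<^term>\<open>rot\<close> sends a dart to the
  next one in counterclockwise order around the vertex it stems from, and \<^term>\<open>opp\<close> reverses a dart.
  Vertices, edges and faces are then sets of darts. Embedded maps up to orientation-preserving
  homeomorphism are these structures up to isomorphism, and the surface is a sphere if and only if
  Euler's formula V - E + F = 2 holds.
\<close>

record 'd rmap =
  darts :: "'d set"
  rot :: "'d \<Rightarrow> 'd"
  opp :: "'d \<Rightarrow> 'd"
  root_dart :: 'd

definition vertex_of :: "'d rmap \<Rightarrow> 'd \<Rightarrow> 'd set" where
  "vertex_of M d = orbit (rot M) d"

definition edge_of :: "'d rmap \<Rightarrow> 'd \<Rightarrow> 'd set" where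
  "edge_of M d = {d, opp M d}"

text \<open>
  The face to the right of a dart. Following \<open>d\<close> with the face on the right, the next dart of the
  contour is the counterclockwise successor of \<open>opp d\<close> around the endpoint of \<open>d\<close>. The face is
  represented by the set of all darts that have it on their right. In particular the corner of this
  face at the origin of \<open>d\<close> lies immediately clockwise from \<open>d\<close>, and the face to the left of \<open>d\<close> is
  the face to the right of \<open>opp d\<close>.
\<close>

definition face_of :: "'d rmap \<Rightarrow> 'd \<Rightarrow> 'd set" where
  "face_of M d = orbit (rot M \<circ> opp M) d"

definition vertices :: "'d rmap \<Rightarrow> 'd set set" where
  "vertices M = vertex_of M ` darts M"

definition edges :: "'d rmap \<Rightarrow> 'd set set" where
  "edges M = edge_of M ` darts M"

definition faces :: "'d rmap \<Rightarrow> 'd set set" where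
  "faces M = face_of M ` darts M"

definition root_vertex :: "'d rmap \<Rightarrow> 'd set" where
  "root_vertex M = vertex_of M (root_dart M)"

definition root_face :: "'d rmap \<Rightarrow> 'd set" where
  "root_face M = face_of M (root_dart M)"

definition connected_map :: "'d rmap \<Rightarrow> bool" where
  "connected_map M \<longleftrightarrow>
     (\<forall>d\<in>darts M. \<forall>e\<in>darts M.
        (d, e) \<in> ({(x, rot M x) | x. x \<in> darts M} \<union> {(x, opp M x) | x. x \<in> darts M})\<^sup>*)"

definition rooted_map :: "'d rmap \<Rightarrow> bool" where
  "rooted_map M \<longleftrightarrow>
     finite (darts M) \<and> root_dart M \<in> darts M \<and>
     rot M permutes darts M \<and> opp M permutes darts M \<and>
     (\<forall>d\<in>darts M. opp M d \<noteq> d \<and> opp M (opp M d) = d) \<and>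
     connected_map M"

definition planar_map :: "'d rmap \<Rightarrow> bool" where
  "planar_map M \<longleftrightarrow>
     rooted_map M \<and> card (vertices M) + card (faces M) = card (edges M) + 2"

definition cubic :: "'d rmap \<Rightarrow> bool" where
  "cubic M \<longleftrightarrow> (\<forall>v\<in>vertices M. card v = 3)"

datatype vcolour = Black | White

definition vertex_colouring :: "'d rmap \<Rightarrow> ('d set \<Rightarrow> vcolour) \<Rightarrow> bool" where
  "vertex_colouring M w \<longleftrightarrow> (\<forall>d\<in>darts M. w (vertex_of M d) \<noteq> w (vertex_of M (opp M d)))"

definition bipartite :: "'d rmap \<Rightarrow> bool" where
  "bipartite M \<longleftrightarrow> (\<exists>w. vertex_colouring M w)"

definition bicubic :: "'d rmap \<Rightarrow> bool" where
  "bicubic M \<longleftrightarrow> planar_map M \<and> cubic M \<and> bipartite M"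

text \<open>
  Going counterclockwise around a vertex, the corner of \<^term>\<open>face_of M d\<close> is followed by the corner
  of \<^term>\<open>face_of M (rot M d)\<close>.
\<close>

definition face_colouring ::
    "'d rmap \<Rightarrow> ('d set \<Rightarrow> vcolour) \<Rightarrow> ('d set \<Rightarrow> nat) \<Rightarrow> bool" where
  "face_colouring M w f \<longleftrightarrow>
     (\<forall>F\<in>faces M. f F \<in> {1, 2, 3}) \<and>
     (\<forall>d\<in>darts M. f (face_of M d) \<noteq> f (face_of M (opp M d))) \<and>
     (\<forall>d\<in>darts M. w (vertex_of M d) = White \<longrightarrow>
        (f (face_of M d), f (face_of M (rot M d))) \<in> {(1, 2), (2, 3), (3, 1)})"

text \<open>
  On a bicubic map the pair of colourings below exists and is unique on vertices and faces, so this
  is the colour of \<open>F\<close> in the canonical colouring.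
\<close>

definition has_colour :: "'d rmap \<Rightarrow> 'd set \<Rightarrow> nat \<Rightarrow> bool" where
  "has_colour M F i \<longleftrightarrow>
     (\<exists>w f. vertex_colouring M w \<and> w (root_vertex M) = Black \<and>
            face_colouring M w f \<and> f (root_face M) = 3 \<and> f F = i)"

text \<open>\<open>around_root M i\<close> is the face \<open>R\<^sub>i\<close>: the face around the root vertex that has colour \<open>i\<close>.\<close>

definition around_root :: "'d rmap \<Rightarrow> nat \<Rightarrow> 'd set" where
  "around_root M i = (THE F. F \<in> face_of M ` root_vertex M \<and> has_colour M F i)"

text \<open>An edge is on the boundary of a face if one of its two darts has the face on its right.\<close>

definition touches :: "'d rmap \<Rightarrow> 'd set \<Rightarrow> 'd set \<Rightarrow> bool" where
  "touches M F G \<longleftrightarrow> (\<exists>e\<in>edges M. e \<inter> F \<noteq> {} \<and> e \<inter> G \<noteq> {})"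

definition rmap_a :: "'d rmap \<Rightarrow> nat" where
  "rmap_a M = card {F \<in> faces M. has_colour M F 1 \<and> touches M F (root_face M)}"

definition rmap_c :: "'d rmap \<Rightarrow> nat" where
  "rmap_c M = card {F \<in> faces M. has_colour M F 3 \<and> touches M F (around_root M 2)}"

definition map_iso :: "('d rmap \<times> 'd rmap) set" where
  "map_iso = {(M, N). rooted_map M \<and> rooted_map N \<and>
     (\<exists>h. bij_betw h (darts M) (darts N) \<and>
          (\<forall>d\<in>darts M. h (rot M d) = rot N (h d) \<and> h (opp M d) = opp N (h d)) \<and>
          h (root_dart M) = root_dart N)}"

text \<open>
  Maps in the sense of the literature are isomorphism classes. Every finite map has an isomorphic
  copy with darts in \<^typ>\<open>nat\<close>, so each bicubic map on \<open>n\<close> vertices is exactly one element of the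
  following (finite) set.
\<close>

definition bicubic_maps :: "nat \<Rightarrow> nat rmap set set" where
  "bicubic_maps n = {M. bicubic M \<and> card (vertices M) = n} // map_iso"

text \<open>
  The statistics are invariant under isomorphism, so their image of a class is a singleton.
\<close>

definition class_stat :: "('d rmap \<Rightarrow> nat) \<Rightarrow> 'd rmap set \<Rightarrow> nat" where
  "class_stat s C = the_elem (s ` C)"

definition stat_a :: "nat rmap set \<Rightarrow> nat" where
  "stat_a = class_stat rmap_a"

definition stat_c :: "nat rmap set \<Rightarrow> nat" where
  "stat_c = class_stat rmap_c"

end

theory Submission
  imports Defs
begin

text \<open>
  Turning the root one step counterclockwise around the root vertex makes \<open>R\<^sub>2\<close> the root face. The
  canonical colouring of the new map is the old one with the colours permuted cyclically, so that
  the colour 3 becomes 1. Hence the 3-coloured faces touching \<open>R\<^sub>2\<close> are the 1-coloured faces touching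
  the new root face, and the statistic \<open>c\<close> of a map is the statistic \<open>a\<close> of the map with turned root.
\<close>

definition turn_root :: "'d rmap \<Rightarrow> 'd rmap" where
  "turn_root M = M\<lparr>root_dart := rot M (root_dart M)\<rparr>"

definition next_colour :: "nat \<Rightarrow> nat" where
  "next_colour i = (if i = 3 then 1 else Suc i)"

section \<open>Invariance under turning the root\<close>

lemma turn_root_simps [simp]:
  "darts (turn_root M) = darts M"
  "rot (turn_root M) = rot M"
  "opp (turn_root M) = opp M"
  "root_dart (turn_root M) = rot M (root_dart M)"
  by (simp_all add: turn_root_def)

text \<open>All these notions are built from \<open>darts\<close>, \<open>rot\<close> and
  \<open>opp\<close> alone.\<close>

lemma turn_root_derived_simps [simp]:
  "vertex_of (turn_root M) = vertex_of M"
  "edge_of (turn_root M) = edge_of M"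
  "face_of (turn_root M) = face_of M"
  "vertices (turn_root M) = vertices M"
  "edges (turn_root M) = edges M"
  "faces (turn_root M) = faces M"
  "touches (turn_root M) = touches M"
  "connected_map (turn_root M) = connected_map M"
  "cubic (turn_root M) = cubic M"
  "vertex_colouring (turn_root M) = vertex_colouring M"
  "bipartite (turn_root M) = bipartite M"
  "face_colouring (turn_root M) = face_colouring M"
  by (simp_all add: fun_eq_iff vertex_of_def edge_of_def face_of_def vertices_def edges_def
      faces_def touches_def connected_map_def cubic_def vertex_colouring_def bipartite_def
      face_colouring_def)

lemma rooted_mapD:
  assumes "rooted_map M"
  shows "permutation (rot M)" "permutation (rot M \<circ> opp M)"
    and "\<And>d. rot M d \<in> darts M \<longleftrightarrow> d \<in> darts M"
    and "\<And>d. opp M d \<in> darts M \<longleftrightarrow> d \<in> darts M"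
    and "\<And>d. d \<in> darts M \<Longrightarrow> opp M (opp M d) = d"
    and "root_dart M \<in> darts M"
  using assms permutes_in_image[of "rot M" "darts M"] permutes_in_image[of "opp M" "darts M"]
  by (auto simp: rooted_map_def intro: permutation_compose permutes_imp_permutation)

lemma rooted_map_turn_root [simp]: "rooted_map (turn_root M) \<longleftrightarrow> rooted_map M"
  by (auto simp: rooted_map_def permutes_in_image)

lemma bicubic_turn_root [simp]: "bicubic (turn_root M) \<longleftrightarrow> bicubic M"
  by (simp add: bicubic_def planar_map_def)

lemma vertex_of_rot:
  assumes "rooted_map M"
  shows "vertex_of M (rot M d) = vertex_of M d"
  unfolding vertex_of_def by (intro permutation_orbit_step rooted_mapD(1) assms)

lemma face_of_rot_opp:
  assumes "rooted_map M"
  shows "face_of M (rot M (opp M d)) = face_of M d"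
  using permutation_orbit_step[OF rooted_mapD(2)[OF assms], of d] by (simp add: face_of_def)

lemma root_vertex_turn_root:
  "rooted_map M \<Longrightarrow> root_vertex (turn_root M) = root_vertex M"
  by (simp add: root_vertex_def vertex_of_rot)

lemma root_face_turn_root: "root_face (turn_root M) = face_of M (rot M (root_dart M))"
  by (simp add: root_face_def)

section \<open>Colours around black vertices and cyclic recolouring\<close>

text \<open>The dart \<open>opp M d\<close> starts at a white vertex and has the same two faces on
  its sides as \<open>d\<close>, with left and right exchanged. The counterclockwise order 1, 2, 3
  at white vertices thus becomes clockwise at black ones.\<close>

lemma face_colouring_black:
  assumes M: "rooted_map M" and w: "vertex_colouring M w" and f: "face_colouring M w f"
    and d: "d \<in> darts M" "w (vertex_of M d) = Black"
  shows "(f (face_of M (rot M d)), f (face_of M d)) \<in> {(1, 2), (2, 3), (3, 1)}"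
proof -
  have opp: "opp M d \<in> darts M" "opp M (opp M d) = d"
    using rooted_mapD[OF M] d by auto
  moreover have "w (vertex_of M (opp M d)) = White"
    using w d unfolding vertex_colouring_def by (metis vcolour.exhaust)
  ultimately have
    "(f (face_of M (opp M d)), f (face_of M (rot M (opp M d)))) \<in> {(1, 2), (2, 3), (3, 1)}"
    using f unfolding face_colouring_def by blast
  moreover have "face_of M (rot M d) = face_of M (opp M d)"
    using face_of_rot_opp[OF M, of "opp M d"] opp by simp
  ultimately show ?thesis
    using face_of_rot_opp[OF M, of d] by simp
qed

lemma face_colouring_next_colour:
  assumes M: "rooted_map M" and f: "face_colouring M w f"
  shows "face_colouring M w (next_colour \<circ> f)"
proof -
  let ?C = "{(1, 2), (2, 3), (3, 1)} :: (nat \<times> nat) set"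
  have f3: "f F \<in> {1, 2, 3}" if "F \<in> faces M" for F
    using f that unfolding face_colouring_def by blast
  have range: "next_colour i \<in> {1, 2, 3}" if "i \<in> {1, 2, 3}" for i
    using that by (auto simp: next_colour_def)
  \<comment> \<open>The restriction to colours matters: \<open>next_colour\<close> sends both 0 and
    3 to 1.\<close>
  have inj: "next_colour i \<noteq> next_colour j" if "i \<noteq> j" "i \<in> {1, 2, 3}" "j \<in> {1, 2, 3}" for i j
    using that by (auto simp: next_colour_def)
  have cyc: "(next_colour i, next_colour j) \<in> ?C" if "(i, j) \<in> ?C" for i j
    using that by (auto simp: next_colour_def)
  show ?thesis
    unfolding face_colouring_def o_def
  proof (intro conjI ballI impI)
    fix F assume "F \<in> faces M"
    then show "next_colour (f F) \<in> {1, 2, 3}"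
      by (intro range f3)
  next
    fix d assume d: "d \<in> darts M"
    then have "f (face_of M d) \<noteq> f (face_of M (opp M d))"
      using f unfolding face_colouring_def by blast
    then show "next_colour (f (face_of M d)) \<noteq> next_colour (f (face_of M (opp M d)))"
      using d rooted_mapD(4)[OF M] by (intro inj f3) (simp_all add: faces_def)
  next
    fix d assume "d \<in> darts M" "w (vertex_of M d) = White"
    then show "(next_colour (f (face_of M d)), next_colour (f (face_of M (rot M d)))) \<in> ?C"
      using f unfolding face_colouring_def by (intro cyc) blast
  qed
qed

text \<open>The root vertex stays the same, so \<open>w\<close> still makes it black. Only the
  colour of the root face has to be readjusted to 3, by a cyclic shift of \<open>f\<close>.\<close>

lemma has_colour_turn_root:
  assumes M: "rooted_map M" and F: "F \<in> faces M"
  shows "has_colour (turn_root M) F 1 \<longleftrightarrow> has_colour M F 3"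
proof
  let ?r = "root_dart M"
  assume "has_colour M F 3"
  then obtain w f where wf: "vertex_colouring M w" "w (root_vertex M) = Black"
      "face_colouring M w f" "f (root_face M) = 3" "f F = 3"
    unfolding has_colour_def by blast
  then have "f (face_of M (rot M ?r)) = 2"
    using face_colouring_black[OF M, of w f ?r] rooted_mapD(6)[OF M]
    by (auto simp: root_vertex_def root_face_def)
  then show "has_colour (turn_root M) F 1"
    using wf face_colouring_next_colour[OF M wf(3)] unfolding has_colour_def
    by (intro exI[of _ w] exI[of _ "next_colour \<circ> f"])
      (simp add: root_vertex_turn_root[OF M] root_face_turn_root next_colour_def)
next
  let ?r = "root_dart M"
  assume "has_colour (turn_root M) F 1"
  then obtain w f where wf: "vertex_colouring M w" "w (root_vertex M) = Black"
      "face_colouring M w f" "f (face_of M (rot M ?r)) = 3" "f F = 1"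
    unfolding has_colour_def by (auto simp: root_vertex_turn_root[OF M] root_face_turn_root)
  then have "f (root_face M) = 1"
    using face_colouring_black[OF M, of w f ?r] rooted_mapD(6)[OF M]
    by (auto simp: root_vertex_def root_face_def)
  \<comment> \<open>\<open>next_colour\<close> has order 3 on the colours, so applying it twice
    undoes the shift and sends 1 back to 3.\<close>
  then show "has_colour M F 3"
    using wf face_colouring_next_colour[OF M face_colouring_next_colour[OF M wf(3)]]
    unfolding has_colour_def
    by (intro exI[of _ w] exI[of _ "next_colour \<circ> (next_colour \<circ> f)"]) (simp add: next_colour_def)
qed

section \<open>The face of colour 2 at the root vertex\<close>

text \<open>Counterclockwise from the root corner, every canonical colouring reads 3, 2, 1, so
  exactly one face at the root vertex has colour 2. The assumption \<open>col\<close>, for any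
  \<open>F\<close> and \<open>i\<close>, supplies such a colouring.\<close>

lemma around_root_2:
  assumes M: "rooted_map M"
    and cubic: "rot M (rot M (rot M (root_dart M))) = root_dart M"
    and col: "has_colour M F i"
  shows "around_root M 2 = root_face (turn_root M)"
proof -
  let ?r = "root_dart M"
  have rv: "root_vertex M = {?r, rot M ?r, rot M (rot M ?r)}"
  proof -
    have "orbit (rot M) ?r = (\<lambda>m. (rot M ^^ m) ?r) ` {..<3}"
      using orbit_altdef_bounded[of 3 "rot M" ?r] cubic
      by (simp add: numeral_3_eq_3 setcompr_eq_image lessThan_def)
    also have "{..<3 :: nat} = {0, 1, 2}"
      by auto
    finally show ?thesis
      by (simp add: root_vertex_def vertex_of_def numeral_2_eq_2)
  qed
  have colours: "f (face_of M (rot M ?r)) = 2 \<and> f (face_of M (rot M (rot M ?r))) = 1"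
    if "vertex_colouring M w" "w (root_vertex M) = Black" "face_colouring M w f"
      "f (root_face M) = 3" for w f
  proof -
    have r: "?r \<in> darts M" "rot M ?r \<in> darts M"
      using rooted_mapD[OF M] by simp_all
    have black: "w (vertex_of M ?r) = Black" "w (vertex_of M (rot M ?r)) = Black"
      using that(2) by (simp_all add: root_vertex_def vertex_of_rot[OF M])
    have "f (face_of M (rot M ?r)) = 2"
      using face_colouring_black[OF M that(1,3) r(1) black(1)] that(4)
      by (auto simp: root_face_def)
    then show ?thesis
      using face_colouring_black[OF M that(1,3) r(2) black(2)] by auto
  qed
  have "has_colour M (face_of M (rot M ?r)) 2"
    using col colours unfolding has_colour_def by blast
  \<comment> \<open>The colouring that witnesses colour 2 for \<open>G\<close> also gives 3 and 1 to
    the other two corners, which rules them out.\<close>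
  moreover have "G = face_of M (rot M ?r)"
    if G: "G \<in> face_of M ` root_vertex M" "has_colour M G 2" for G
  proof -
    obtain w f where wf: "vertex_colouring M w" "w (root_vertex M) = Black"
        "face_colouring M w f" "f (root_face M) = 3" "f G = 2"
      using G(2) unfolding has_colour_def by blast
    then show ?thesis
      using G(1) colours[OF wf(1-4)] by (auto simp: rv root_face_def)
  qed
  moreover have "face_of M (rot M ?r) \<in> face_of M ` root_vertex M"
    by (simp add: rv)
  ultimately have "around_root M 2 = face_of M (rot M ?r)"
    unfolding around_root_def by (intro the_equality) blast+
  then show ?thesis
    by (simp add: root_face_turn_root)
qed

text \<open>
  If no face had colour 3, \<open>around_root\<close> would be a junk value, but then both counted sets are empty.
  Thus the existence of the canonical colouring is never used.
\<close>

lemma rmap_c_eq_rmap_a_turn_root: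
  assumes "rooted_map M" "rot M (rot M (rot M (root_dart M))) = root_dart M"
  shows "rmap_c M = rmap_a (turn_root M)"
proof -
  have "{F \<in> faces M. has_colour M F 3 \<and> touches M F (around_root M 2)} =
      {F \<in> faces M. has_colour (turn_root M) F 1 \<and> touches M F (root_face (turn_root M))}"
    by (intro Collect_cong conj_cong refl)
      (simp_all only: has_colour_turn_root[OF assms(1)] around_root_2[OF assms])
  then show ?thesis
    by (simp add: rmap_c_def rmap_a_def)
qed

section \<open>Degree three as an equation for \<open>rot\<close>\<close>

text \<open>The size of the orbit is the first return time
  \<open>funpow_dist1 f x x\<close>.\<close>

lemma funpow_card_orbit:
  assumes "x \<in> orbit f x"
  shows "(f ^^ card (orbit f x)) x = x"
proof -
  have "card (orbit f x) = funpow_dist1 f x x"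
    using card_image[OF inj_on_funpow_dist1[OF assms]] orbit_conv_funpow_dist1[OF assms] by simp
  then show ?thesis
    using funpow_dist1_prop[OF assms] by simp
qed

lemma rot_cubic:
  assumes "rooted_map M" "cubic M" "d \<in> darts M"
  shows "rot M (rot M (rot M d)) = d"
proof -
  have "card (orbit (rot M) d) = 3"
    using assms(2,3) by (auto simp: cubic_def vertices_def vertex_of_def)
  then show ?thesis
    using funpow_card_orbit[OF permutation_self_in_orbit[OF rooted_mapD(1)[OF assms(1)]], of d]
    by (simp add: numeral_3_eq_3)
qed

section \<open>Turning the root on isomorphism classes\<close>

text \<open>The same bijection \<open>h\<close> serves both sides: it commutes with
  \<open>rot\<close>, and \<open>rot N\<close> is injective, so matching the turned roots amounts to
  matching the original ones.\<close>

lemma turn_root_map_iso_iff: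
  assumes M: "rooted_map M" and N: "rooted_map N"
  shows "(turn_root M, turn_root N) \<in> map_iso \<longleftrightarrow> (M, N) \<in> map_iso"
proof -
  let ?hom = "\<lambda>h. \<forall>d\<in>darts M. h (rot M d) = rot N (h d) \<and> h (opp M d) = opp N (h d)"
  have "h (rot M (root_dart M)) = rot N (root_dart N) \<longleftrightarrow> h (root_dart M) = root_dart N"
    if "?hom h" for h
  proof -
    have "h (rot M (root_dart M)) = rot N (h (root_dart M))"
      using that rooted_mapD(6)[OF M] by blast
    then show ?thesis
      using bij_is_inj[OF permutation_bijective[OF rooted_mapD(1)[OF N]]] by (simp add: inj_eq)
  qed
  then have "?hom h \<and> h (rot M (root_dart M)) = rot N (root_dart N) \<longleftrightarrow>
      ?hom h \<and> h (root_dart M) = root_dart N" for h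
    by blast
  then show ?thesis
    using M N by (simp only: map_iso_def mem_Collect_eq case_prod_conv turn_root_simps
        rooted_map_turn_root)
qed

lemma turn_root_surj:
  assumes "rooted_map M"
  obtains M' where "M = turn_root M'"
proof
  have "rot M (inv (rot M) (root_dart M)) = root_dart M"
    using bij_is_surj[OF permutation_bijective[OF rooted_mapD(1)[OF assms]]] by (simp add: surj_f_inv_f)
  then show "M = turn_root (M\<lparr>root_dart := inv (rot M) (root_dart M)\<rparr>)"
    by (simp add: turn_root_def)
qed

lemma turn_root_inject:
  assumes "rooted_map M" "turn_root M = turn_root N"
  shows "M = N"
proof -
  have "darts M = darts N" "rot M = rot N" "opp M = opp N" "rmap.more M = rmap.more N"
    "rot M (root_dart M) = rot N (root_dart N)"
    using arg_cong[OF assms(2), of darts] arg_cong[OF assms(2), of rot]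
      arg_cong[OF assms(2), of opp] arg_cong[OF assms(2), of root_dart] by simp_all
  moreover have "inj (rot M)"
    by (intro bij_is_inj permutation_bijective rooted_mapD(1) assms(1))
  ultimately show ?thesis
    by (metis injD rmap.equality)
qed

lemma turn_root_image_map_iso:
  assumes "rooted_map M"
  shows "turn_root ` (map_iso `` {M}) = map_iso `` {turn_root M}"
proof (intro set_eqI iffI)
  fix N assume "N \<in> turn_root ` (map_iso `` {M})"
  then obtain N' where N': "N = turn_root N'" "(M, N') \<in> map_iso"
    by blast
  then show "N \<in> map_iso `` {turn_root M}"
    using turn_root_map_iso_iff[OF assms] by (simp add: map_iso_def)
next
  fix N assume "N \<in> map_iso `` {turn_root M}"
  then have N: "(turn_root M, N) \<in> map_iso" "rooted_map N"
    by (auto simp: map_iso_def)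
  obtain N' where N': "N = turn_root N'"
    using turn_root_surj[OF N(2)] .
  then show "N \<in> turn_root ` (map_iso `` {M})"
    using turn_root_map_iso_iff[OF assms, of N'] N by simp
qed

lemma bij_betw_turn_root_bicubic_maps:
  "bij_betw (image turn_root) (bicubic_maps n) (bicubic_maps n)"
proof -
  let ?B = "{M :: nat rmap. bicubic M \<and> card (vertices M) = n}"
  have rooted: "rooted_map M" if "M \<in> ?B" for M
    using that by (simp add: bicubic_def planar_map_def)
  \<comment> \<open>Injectivity of \<open>turn_root\<close> is available on rooted maps only;
    \<open>map_iso\<close> relates no others, so every class lies in that domain.\<close>
  have class_rooted: "C \<subseteq> {M. rooted_map M}" if "C \<in> bicubic_maps n" for C
    using that unfolding bicubic_maps_def quotient_def by (auto simp: map_iso_def)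
  have "inj_on turn_root {M :: nat rmap. rooted_map M}"
    by (auto intro: inj_onI turn_root_inject)
  then have "inj_on (image turn_root) (bicubic_maps n)"
    using class_rooted by (meson inj_onI inj_on_image_eq_iff)
  moreover have "image turn_root ` bicubic_maps n = bicubic_maps n"
  proof (intro set_eqI iffI)
    fix D assume "D \<in> image turn_root ` bicubic_maps n"
    then obtain M where M: "M \<in> ?B" "D = turn_root ` (map_iso `` {M})"
      unfolding bicubic_maps_def quotient_def by blast
    then show "D \<in> bicubic_maps n"
      unfolding M(2) turn_root_image_map_iso[OF rooted[OF M(1)]] bicubic_maps_def
      by (intro quotientI) simp
  next
    fix D assume "D \<in> bicubic_maps n"
    then obtain M where M: "M \<in> ?B" "D = map_iso `` {M}"
      unfolding bicubic_maps_def quotient_def by blast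
    \<comment> \<open>\<open>M'\<close> has its root turned back by one step; it is again bicubic
      with the same vertices, so its class is a preimage of \<open>D\<close>.\<close>
    obtain M' where M': "M = turn_root M'"
      using turn_root_surj[OF rooted[OF M(1)]] .
    then have M'_in: "M' \<in> ?B"
      using M(1) by simp
    then have "map_iso `` {M'} \<in> bicubic_maps n"
      unfolding bicubic_maps_def by (rule quotientI)
    moreover have "D = turn_root ` (map_iso `` {M'})"
      using turn_root_image_map_iso[OF rooted[OF M'_in]] M(2) M' by simp
    ultimately show "D \<in> image turn_root ` bicubic_maps n"
      by blast
  qed
  ultimately show ?thesis
    unfolding bij_betw_def by blast
qed

text \<open>The comparison of the statistics is made for every member of a class, while bicubicity
  is given for one representative. This carries the required equation at the root over to the
  others.\<close>

lemma map_iso_root_cubic: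
  assumes "(M, N) \<in> map_iso" "rot M (rot M (rot M (root_dart M))) = root_dart M"
  shows "rot N (rot N (rot N (root_dart N))) = root_dart N"
proof -
  from assms(1) obtain h where "rooted_map M"
      "\<forall>d\<in>darts M. h (rot M d) = rot N (h d)" "h (root_dart M) = root_dart N"
    unfolding map_iso_def by blast
  then show ?thesis
    using assms(2) rooted_mapD(3,6)[of M] by metis
qed

text \<open>The two statistics agree representative by representative, so both sides apply
  \<open>the_elem\<close> to the same set of values.\<close>

lemma stat_c_eq_stat_a_turn_root:
  assumes "C \<in> bicubic_maps n"
  shows "stat_c C = stat_a (turn_root ` C)"
proof -
  obtain M where M: "bicubic M" "C = map_iso `` {M}"
    using assms unfolding bicubic_maps_def quotient_def by blast
  have "rmap_c N = rmap_a (turn_root N)" if "N \<in> C" for N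
  proof (rule rmap_c_eq_rmap_a_turn_root)
    have iso: "(M, N) \<in> map_iso"
      using that M(2) by simp
    then show "rooted_map N"
      by (simp add: map_iso_def)
    show "rot N (rot N (rot N (root_dart N))) = root_dart N"
      using iso M(1) by (intro map_iso_root_cubic[OF iso] rot_cubic)
        (auto simp: bicubic_def planar_map_def rooted_mapD(6))
  qed
  then have "rmap_c ` C = rmap_a ` turn_root ` C"
    by (auto simp: image_image)
  then show ?thesis
    by (simp add: stat_c_def stat_a_def class_stat_def)
qed

theorem proposition1:
  fixes n :: nat
  assumes "n > 0"
  shows "(\<Sum>M\<in>bicubic_maps n. monom (1::int) (stat_a M)) = (\<Sum>M\<in>bicubic_maps n. monom 1 (stat_c M))"
proof -
  have "(\<Sum>M\<in>bicubic_maps n. monom (1::int) (stat_a M)) =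
      (\<Sum>M\<in>bicubic_maps n. monom 1 (stat_a (turn_root ` M)))"
    by (rule sum.reindex_bij_betw[OF bij_betw_turn_root_bicubic_maps, symmetric])
  also have "\<dots> = (\<Sum>M\<in>bicubic_maps n. monom 1 (stat_c M))"
    by (simp add: stat_c_eq_stat_a_turn_root)
  finally show ?thesis .
qed

end
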